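(* Let $A\in(\overline{\Lambda}^{(1)})^{q\times q}$ with $I_q-A$ invertible and $C\in(\overline{\Lambda}^{(1)})^{p\times q}$ be such that $(C,A)$ is an observable pair, let $J\in(\overline{\Lambda}^{(1)})^{p\times p}$ be a signature matrix ($J=J^*$, $JJ^*=I_p$), let $P\in(\overline{\Lambda}^{(1)})^{q\times q}$ be an invertible self-adjoint matrix, and let $$\Theta(z)=I_p-(1-z)C\star(I_q-zA)^{-\star}P^{-1}(I_q-A)^{-*}C^*J .$$ Then the equation $$\sum_{n=0}^\infty z^n\left(J-\Theta(z)J\Theta(w)^*\right)(w^\dag)^n=C\star(I_q-zA)^{-\star}P^{-1}\left[(I_q-wA)^*\right]^{-\star_r}\star_rC^*$$ holds (for all $z,w\in\overline{\Lambda}^{(1)}$ in a neighborhood of the origin) if and only if $$P-A^*PA=C^*JC .$$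
   Context: $\Lambda$ is the unital complex algebra generated by $1$ and countably many elements $i_1,i_2,\ldots$, linearly independent over $\mathbb{C}$, with $i_ni_m+i_mi_n=0$ (so $i_n^2=0$). With $i_\alpha=i_{a_1}\cdots i_{a_t}$ and $|\alpha|=t$ for finite strictly increasing tuples $\alpha=(a_1<\cdots<a_t)$ of positive integers, $\overline{\Lambda}^{(1)}$ is the Banach algebra of all sums $z=z_0+\sum_\alpha z_\alpha i_\alpha$, $z_\alpha\in\mathbb{C}$, with $\|z\|_1=|z_0|+\sum_\alpha|z_\alpha|<\infty$. Conjugation: $z^\dag=\overline{z_0}+\sum_\alpha(-1)^{|\alpha|(|\alpha|-1)/2}\overline{z_\alpha}i_\alpha$, with $(zw)^\dag=w^\dag z^\dag$; for matrices, $M^*$ has $(j,k)$ entry $m_{kj}^\dag$, and $M^{-*}=(M^{-1})^*$. $(C,A)$ is observable if $\bigcap_{u\ge0}\ker CA^u=\{0\}$, the kernels being taken in $(\overline{\Lambda}^{(1)})^{q}$. For power series $F(z)=\sum z^nf_n$, $G(z)=\sum z^ng_n$ with matrix coefficients over $\overline{\Lambda}^{(1)}$ and $z\in\overline{\Lambda}^{(1)}$, $F\star G=\sum_nz^n\sum_{u=0}^nf_ug_{n-u}$, and $F^{-\star}$ is the $\star$-inverse; thus $C\star(I_q-zA)^{-\star}=\sum_n z^nCA^n$. The factor $(1-z)$ in $\Theta$ is likewise a $\star$-factor. For power series with powers on the right, $(\sum f_nz^n)\star_r(\sum g_nz^n)=\sum_n(\sum_{u=0}^nf_ug_{n-u})z^n$,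 with $\star_r$-inverse $(\cdot)^{-\star_r}$; it is applied in the variable $w^\dag$, so $[(I_q-wA)^*]^{-\star_r}\star_rC^*=\sum_n(A^* )^nC^*(w^\dag)^n$. Hence the right-hand side is $\sum_{n,m}z^nCA^nP^{-1}(A^* )^mC^*(w^\dag)^m$. $\Theta(z)$ denotes the value of the power series at $z$. *)

theory Defs
  imports "HOL-Analysis.Finite_Cartesian_Product" "HOL-Analysis.Infinite_Sum" "HOL-Library.FSet"
begin

section \<open>The Grassmann Banach algebra\<close>

text \<open>
  An element \<open>z = \<Sum>\<alpha>. z\<^sub>\<alpha> i\<^sub>\<alpha>\<close> is represented by its family of coefficients.  A strictly
  increasing tuple \<open>\<alpha>\<close> is the same thing as a finite set, the empty set standing for the
  basis element \<open>1\<close>.  The generators are numbered from 0 instead of 1.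
\<close>

typedef grassmann = "{f :: nat fset \<Rightarrow> complex. f abs_summable_on UNIV}"
  morphisms gcoeff Abs_grassmann
  by (rule exI[of _ "\<lambda>_. 0"]) simp

setup_lifting type_definition_grassmann

lemma grassmann_eq_iff: "z = w \<longleftrightarrow> (\<forall>\<alpha>. gcoeff z \<alpha> = gcoeff w \<alpha>)"
  by transfer auto

lemma abs_summable_UNIV_bounded:
  fixes f :: "'i \<Rightarrow> 'b::real_normed_vector"
  assumes "\<And>F. finite F \<Longrightarrow> (\<Sum>x\<in>F. norm (f x)) \<le> B"
  shows "f abs_summable_on UNIV" "(\<Sum>\<^sub>\<infinity>x. norm (f x)) \<le> B"
proof -
  show *: "f abs_summable_on UNIV"
    by (rule nonneg_bdd_above_summable_on) (auto intro!: bdd_aboveI2[where M = B] assms)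
  show "(\<Sum>\<^sub>\<infinity>x. norm (f x)) \<le> B"
    by (rule infsum_le_finite_sums[OF *]) (use assms in auto)
qed

lemma sum_norm_le_infsum:
  fixes f :: "'i \<Rightarrow> 'b::real_normed_vector"
  assumes "f abs_summable_on UNIV" "finite F"
  shows "(\<Sum>x\<in>F. norm (f x)) \<le> (\<Sum>\<^sub>\<infinity>x. norm (f x))"
  by (rule finite_sum_le_infsum) (use assms in auto)

instantiation grassmann :: real_vector
begin

lift_definition zero_grassmann :: grassmann is "\<lambda>_. 0" by simp

lift_definition plus_grassmann :: "grassmann \<Rightarrow> grassmann \<Rightarrow> grassmann" is "\<lambda>f g \<alpha>. f \<alpha> + g \<alpha>"
proof -
  fix f g :: "nat fset \<Rightarrow> complex"
  assume "f abs_summable_on UNIV" "g abs_summable_on UNIV"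
  then have "(\<lambda>\<alpha>. norm (f \<alpha>) + norm (g \<alpha>)) summable_on UNIV" by (rule summable_on_add)
  then show "(\<lambda>\<alpha>. f \<alpha> + g \<alpha>) abs_summable_on UNIV"
    by (rule summable_on_comparison_test) (auto intro: norm_triangle_ineq)
qed

lift_definition uminus_grassmann :: "grassmann \<Rightarrow> grassmann" is "\<lambda>f \<alpha>. - f \<alpha>" by simp

lift_definition minus_grassmann :: "grassmann \<Rightarrow> grassmann \<Rightarrow> grassmann" is "\<lambda>f g \<alpha>. f \<alpha> - g \<alpha>"
proof -
  fix f g :: "nat fset \<Rightarrow> complex"
  assume "f abs_summable_on UNIV" "g abs_summable_on UNIV"
  then have "(\<lambda>\<alpha>. norm (f \<alpha>) + norm (g \<alpha>)) summable_on UNIV" by (rule summable_on_add)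
  then show "(\<lambda>\<alpha>. f \<alpha> - g \<alpha>) abs_summable_on UNIV"
    by (rule summable_on_comparison_test) (auto intro: norm_triangle_ineq4)
qed

lift_definition scaleR_grassmann :: "real \<Rightarrow> grassmann \<Rightarrow> grassmann" is "\<lambda>r f \<alpha>. r *\<^sub>R f \<alpha>"
  by (auto intro!: summable_on_cmult_right)

instance
  by standard (transfer; auto simp: algebra_simps scaleR_add_left scaleR_add_right)+

end

lemma gcoeff_simps [simp]:
  "gcoeff 0 \<alpha> = 0" "gcoeff (z + w) \<alpha> = gcoeff z \<alpha> + gcoeff w \<alpha>"
  "gcoeff (z - w) \<alpha> = gcoeff z \<alpha> - gcoeff w \<alpha>" "gcoeff (- z) \<alpha> = - gcoeff z \<alpha>"
  "gcoeff (r *\<^sub>R z) \<alpha> = r *\<^sub>R gcoeff z \<alpha>"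
  by (transfer; simp)+

lemma gcoeff_abs_summable: "gcoeff z abs_summable_on UNIV"
  by transfer

instantiation grassmann :: real_normed_vector
begin

definition norm_grassmann :: "grassmann \<Rightarrow> real" where
  "norm_grassmann z = (\<Sum>\<^sub>\<infinity>\<alpha>. cmod (gcoeff z \<alpha>))"

definition dist_grassmann :: "grassmann \<Rightarrow> grassmann \<Rightarrow> real" where
  "dist_grassmann z w = norm (z - w)"

definition sgn_grassmann :: "grassmann \<Rightarrow> grassmann" where
  "sgn_grassmann z = inverse (norm z) *\<^sub>R z"

definition uniformity_grassmann :: "(grassmann \<times> grassmann) filter" where
  "uniformity_grassmann = (INF e\<in>{0 <..}. principal {(x, y). dist x y < e})"

definition open_grassmann :: "grassmann set \<Rightarrow> bool" where
  "open_grassmann S = (\<forall>x\<in>S. \<forall>\<^sub>F (x', y) in uniformity. x' = x \<longrightarrow> y \<in> S)"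

instance
proof
  fix z w :: grassmann and r :: real
  show "norm z = 0 \<longleftrightarrow> z = 0"
  proof
    assume "norm z = 0"
    then have "cmod (gcoeff z \<alpha>) \<le> 0" for \<alpha>
      using sum_norm_le_infsum[OF gcoeff_abs_summable[of z], of "{\<alpha>}"]
      by (simp add: norm_grassmann_def)
    then show "z = 0" by (simp add: grassmann_eq_iff)
  qed (simp add: norm_grassmann_def)
  have "norm (z + w) \<le> (\<Sum>\<^sub>\<infinity>\<alpha>. cmod (gcoeff z \<alpha>) + cmod (gcoeff w \<alpha>))"
    unfolding norm_grassmann_def
    by (intro infsum_mono gcoeff_abs_summable summable_on_add)
      (simp add: norm_triangle_ineq)
  also have "\<dots> = norm z + norm w"
    unfolding norm_grassmann_def by (rule infsum_add) (rule gcoeff_abs_summable)+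
  finally show "norm (z + w) \<le> norm z + norm w" .
  show "norm (r *\<^sub>R z) = \<bar>r\<bar> * norm z"
    by (simp add: norm_grassmann_def infsum_cmult_right')
qed (simp_all add: dist_grassmann_def sgn_grassmann_def uniformity_grassmann_def
       open_grassmann_def)

end

lemma sum_gcoeff_le_norm: "finite F \<Longrightarrow> (\<Sum>\<alpha>\<in>F. cmod (gcoeff z \<alpha>)) \<le> norm z"
  unfolding norm_grassmann_def by (rule sum_norm_le_infsum[OF gcoeff_abs_summable])

lemma norm_gcoeff_le: "cmod (gcoeff z \<alpha>) \<le> norm z"
  using sum_gcoeff_le_norm[of "{\<alpha>}" z] by simp

instance grassmann :: banach
proof
  fix X :: "nat \<Rightarrow> grassmann"
  assume X: "Cauchy X"
  have "Cauchy (\<lambda>n. gcoeff (X n) \<alpha>)" for \<alpha>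
  proof (rule CauchyI)
    fix e :: real assume "e > 0"
    then obtain M where M: "\<And>m n. m \<ge> M \<Longrightarrow> n \<ge> M \<Longrightarrow> norm (X m - X n) < e"
      using X unfolding Cauchy_iff by blast
    show "\<exists>M. \<forall>m\<ge>M. \<forall>n\<ge>M. norm (gcoeff (X m) \<alpha> - gcoeff (X n) \<alpha>) < e"
    proof (intro exI allI impI)
      fix m n assume "m \<ge> M" "n \<ge> M"
      then have "norm (gcoeff (X m - X n) \<alpha>) < e"
        by (rule le_less_trans[OF norm_gcoeff_le M])
      then show "norm (gcoeff (X m) \<alpha> - gcoeff (X n) \<alpha>) < e" by simp
    qed
  qed
  then have "\<forall>\<alpha>. \<exists>l. (\<lambda>n. gcoeff (X n) \<alpha>) \<longlonglongrightarrow> l"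
    by (meson Cauchy_convergent convergent_def)
  then obtain f where f: "\<And>\<alpha>. (\<lambda>n. gcoeff (X n) \<alpha>) \<longlonglongrightarrow> f \<alpha>" by metis
  have bound: "(\<Sum>\<alpha>\<in>F. cmod (f \<alpha> - gcoeff (X n) \<alpha>)) \<le> e"
    if F: "finite F" and M: "\<And>m. m \<ge> M \<Longrightarrow> norm (X m - X n) \<le> e" for F M n e
  proof (rule LIMSEQ_le_const2)
    show "(\<lambda>m. \<Sum>\<alpha>\<in>F. cmod (gcoeff (X m) \<alpha> - gcoeff (X n) \<alpha>))
            \<longlonglongrightarrow> (\<Sum>\<alpha>\<in>F. cmod (f \<alpha> - gcoeff (X n) \<alpha>))"
      by (intro tendsto_intros f)
    have "(\<Sum>\<alpha>\<in>F. cmod (gcoeff (X m) \<alpha> - gcoeff (X n) \<alpha>)) \<le> e" if "m \<ge> M" for m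
      using sum_gcoeff_le_norm[OF F, of "X m - X n"] M[OF that] by simp
    then show "\<exists>N. \<forall>m\<ge>N. (\<Sum>\<alpha>\<in>F. cmod (gcoeff (X m) \<alpha> - gcoeff (X n) \<alpha>)) \<le> e" by blast
  qed
  have Xe: "\<exists>M. \<forall>m\<ge>M. \<forall>n\<ge>M. norm (X m - X n) \<le> e" if "e > 0" for e
    using X that unfolding Cauchy_iff by (blast intro: less_imp_le)
  obtain M1 where M1: "\<And>m n. m \<ge> M1 \<Longrightarrow> n \<ge> M1 \<Longrightarrow> norm (X m - X n) \<le> 1"
    using Xe[of 1] by auto
  have "f abs_summable_on UNIV"
  proof (rule abs_summable_UNIV_bounded(1))
    fix F :: "nat fset set" assume F: "finite F"
    have "(\<Sum>\<alpha>\<in>F. cmod (f \<alpha>))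
            \<le> (\<Sum>\<alpha>\<in>F. cmod (f \<alpha> - gcoeff (X M1) \<alpha>) + cmod (gcoeff (X M1) \<alpha>))"
      by (rule sum_mono) (use norm_triangle_sub in \<open>simp add: add.commute\<close>)
    also have "\<dots> \<le> 1 + norm (X M1)"
      unfolding sum.distrib
      by (intro add_mono bound[OF F, of M1] sum_gcoeff_le_norm[OF F]) (use M1 in auto)
    finally show "(\<Sum>\<alpha>\<in>F. cmod (f \<alpha>)) \<le> 1 + norm (X M1)" .
  qed
  then obtain x where x: "gcoeff x = f" by (metis Abs_grassmann_inverse mem_Collect_eq)
  have "X \<longlonglongrightarrow> x"
  proof (rule LIMSEQ_I)
    fix e :: real assume "e > 0"
    then obtain M where M: "\<And>m n. m \<ge> M \<Longrightarrow> n \<ge> M \<Longrightarrow> norm (X m - X n) \<le> e / 2"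
      using Xe[of "e/2"] by auto
    have "norm (x - X n) \<le> e / 2" if "n \<ge> M" for n
      unfolding norm_grassmann_def gcoeff_simps x
      by (rule abs_summable_UNIV_bounded(2), rule bound) (use M that in auto)
    then have "norm (x - X n) < e" if "n \<ge> M" for n
      by (rule le_less_trans) (use that \<open>e > 0\<close> in auto)
    then show "\<exists>no. \<forall>n\<ge>no. norm (X n - x) < e" unfolding norm_minus_commute[of "X _" x] by blast
  qed
  then show "convergent X" by (auto simp: convergent_def)
qed

text \<open>
  \<open>i\<^sub>\<alpha> i\<^sub>\<beta> = grassmann_sign \<alpha> \<beta> i\<^sub>\<gamma>\<close> with \<open>\<gamma> = \<alpha> \<union> \<beta>\<close> if \<open>\<alpha>\<close> and \<open>\<beta>\<close> are disjoint, and
  \<open>i\<^sub>\<alpha> i\<^sub>\<beta> = 0\<close> otherwise: sorting the concatenation of \<open>\<alpha>\<close> and \<open>\<beta>\<close> takes one anticommutation for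
  every inversion.
\<close>

definition inversions :: "nat fset \<Rightarrow> nat fset \<Rightarrow> nat" where
  "inversions \<alpha> \<beta> = card {(a, b). a |\<in>| \<alpha> \<and> b |\<in>| \<beta> \<and> b < a}"

definition grassmann_sign :: "nat fset \<Rightarrow> nat fset \<Rightarrow> complex" where
  "grassmann_sign \<alpha> \<beta> = (-1) ^ inversions \<alpha> \<beta>"

definition splittings :: "nat fset \<Rightarrow> (nat fset \<times> nat fset) set" where
  "splittings \<gamma> = {(\<alpha>, \<beta>). \<alpha> |\<inter>| \<beta> = {||} \<and> \<alpha> |\<union>| \<beta> = \<gamma>}"

lemma finite_splittings [simp]: "finite (splittings \<gamma>)"
proof (rule finite_subset)
  show "splittings \<gamma> \<subseteq> fset (fPow \<gamma>) \<times> fset (fPow \<gamma>)"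
    by (auto simp: splittings_def)
qed simp

lemma sum_splittings_single:
  fixes h :: "nat fset \<Rightarrow> nat fset \<Rightarrow> complex"
  assumes "\<And>a b. (a, b) \<in> splittings \<gamma> \<Longrightarrow> (a, b) \<noteq> (a0, b0) \<Longrightarrow> h a b = 0"
  shows "(\<Sum>(a, b)\<in>splittings \<gamma>. h a b) = (if (a0, b0) \<in> splittings \<gamma> then h a0 b0 else 0)"
proof -
  have "(\<Sum>(a, b)\<in>splittings \<gamma>. h a b)
      = (\<Sum>p\<in>splittings \<gamma>. if p = (a0, b0) then h a0 b0 else 0)"
    by (rule sum.cong) (use assms in auto)
  then show ?thesis by simp
qed

lemma splittings_bounds:
  fixes z w :: "nat fset \<Rightarrow> complex"
  assumes z: "z abs_summable_on UNIV" and w: "w abs_summable_on UNIV" and "finite G"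
  shows "(\<Sum>\<gamma>\<in>G. cmod (\<Sum>(\<alpha>, \<beta>)\<in>splittings \<gamma>. grassmann_sign \<alpha> \<beta> * z \<alpha> * w \<beta>))
           \<le> (\<Sum>\<^sub>\<infinity>\<alpha>. cmod (z \<alpha>)) * (\<Sum>\<^sub>\<infinity>\<beta>. cmod (w \<beta>))"
proof -
  define T where "T = (\<Union>\<gamma>\<in>G. splittings \<gamma>)"
  have T: "finite T" using \<open>finite G\<close> by (simp add: T_def)
  have "(\<Sum>\<gamma>\<in>G. cmod (\<Sum>(\<alpha>, \<beta>)\<in>splittings \<gamma>. grassmann_sign \<alpha> \<beta> * z \<alpha> * w \<beta>))
          \<le> (\<Sum>\<gamma>\<in>G. \<Sum>(\<alpha>, \<beta>)\<in>splittings \<gamma>. cmod (z \<alpha>) * cmod (w \<beta>))"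
    by (intro sum_mono order.trans[OF norm_sum])
      (auto simp: norm_mult norm_power grassmann_sign_def)
  also have "\<dots> = (\<Sum>(\<alpha>, \<beta>)\<in>T. cmod (z \<alpha>) * cmod (w \<beta>))"
    unfolding T_def
    by (rule sum.UNION_disjoint[symmetric]) (use \<open>finite G\<close> in simp, simp, auto simp: splittings_def)
  also have "\<dots> \<le> (\<Sum>(\<alpha>, \<beta>)\<in>fst ` T \<times> snd ` T. cmod (z \<alpha>) * cmod (w \<beta>))"
  proof (rule sum_mono2)
    show "T \<subseteq> fst ` T \<times> snd ` T" by (rule subset_fst_snd)
  qed (use T in auto)
  also have "\<dots> = (\<Sum>\<alpha>\<in>fst ` T. cmod (z \<alpha>)) * (\<Sum>\<beta>\<in>snd ` T. cmod (w \<beta>))"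
    by (simp add: sum_product sum.cartesian_product)
  also have "\<dots> \<le> (\<Sum>\<^sub>\<infinity>\<alpha>. cmod (z \<alpha>)) * (\<Sum>\<^sub>\<infinity>\<beta>. cmod (w \<beta>))"
    by (intro mult_mono sum_norm_le_infsum z w) (use T in \<open>auto intro!: sum_nonneg infsum_nonneg\<close>)
  finally show ?thesis .
qed

lemma fdisjointD: "\<alpha> |\<inter>| \<beta> = {||} \<Longrightarrow> x |\<in>| \<alpha> \<Longrightarrow> x |\<notin>| \<beta>"
  by (metis fempty_iff finterI)

lemma inversions_union_left:
  assumes "\<alpha> |\<inter>| \<beta> = {||}"
  shows "inversions (\<alpha> |\<union>| \<beta>) \<gamma> = inversions \<alpha> \<gamma> + inversions \<beta> \<gamma>"
proof -
  have fin: "finite {(a, b). a |\<in>| \<alpha> \<and> b |\<in>| \<gamma> \<and> b < a}" for \<alpha> \<gamma> :: "nat fset"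
    by (rule finite_subset[of _ "fset \<alpha> \<times> fset \<gamma>"]) auto
  have "{(a, b). a |\<in>| \<alpha> |\<union>| \<beta> \<and> b |\<in>| \<gamma> \<and> b < a} =
      {(a, b). a |\<in>| \<alpha> \<and> b |\<in>| \<gamma> \<and> b < a} \<union> {(a, b). a |\<in>| \<beta> \<and> b |\<in>| \<gamma> \<and> b < a}"
    by auto
  then show ?thesis unfolding inversions_def
    by (simp only:) (rule card_Un_disjoint[OF fin fin], use fdisjointD[OF assms] in auto)
qed

lemma inversions_union_right:
  assumes "\<beta> |\<inter>| \<gamma> = {||}"
  shows "inversions \<alpha> (\<beta> |\<union>| \<gamma>) = inversions \<alpha> \<beta> + inversions \<alpha> \<gamma>"
proof -
  have fin: "finite {(a, b). a |\<in>| \<alpha> \<and> b |\<in>| \<gamma> \<and> b < a}" for \<alpha> \<gamma> :: "nat fset"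
    by (rule finite_subset[of _ "fset \<alpha> \<times> fset \<gamma>"]) auto
  have "{(a, b). a |\<in>| \<alpha> \<and> b |\<in>| \<beta> |\<union>| \<gamma> \<and> b < a} =
      {(a, b). a |\<in>| \<alpha> \<and> b |\<in>| \<beta> \<and> b < a} \<union> {(a, b). a |\<in>| \<alpha> \<and> b |\<in>| \<gamma> \<and> b < a}"
    by auto
  then show ?thesis unfolding inversions_def
    by (simp only:) (rule card_Un_disjoint[OF fin fin], use fdisjointD[OF assms] in auto)
qed

lemma inversions_swap:
  assumes "\<alpha> |\<inter>| \<beta> = {||}"
  shows "inversions \<alpha> \<beta> + inversions \<beta> \<alpha> = fcard \<alpha> * fcard \<beta>"
proof -
  let ?S = "{(a, b). a |\<in>| \<alpha> \<and> b |\<in>| \<beta> \<and> b < a}" and ?T = "{(a, b). a |\<in>| \<beta> \<and> b |\<in>| \<alpha> \<and> b < a}"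
  let ?T' = "{(a, b). a |\<in>| \<alpha> \<and> b |\<in>| \<beta> \<and> a < b}"
  have "card ?T = card ?T'"
    by (rule bij_betw_same_card[of prod.swap])
       (auto intro!: bij_betwI[where g = prod.swap])
  moreover have "card ?S + card ?T' = card (?S \<union> ?T')"
    by (rule card_Un_disjoint[symmetric])
       (auto intro: finite_subset[of _ "fset \<alpha> \<times> fset \<beta>"])
  moreover have "?S \<union> ?T' = fset \<alpha> \<times> fset \<beta>"
    using fdisjointD[OF assms] by auto (metis linorder_neqE_nat)
  ultimately show ?thesis
    by (simp add: inversions_def card_cartesian_product fcard.rep_eq)
qed

lemma sum_splittings_assoc:
  "(\<Sum>(\<delta>, c)\<in>splittings \<gamma>. \<Sum>(a, b)\<in>splittings \<delta>. h a b c)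
     = (\<Sum>(a, \<delta>)\<in>splittings \<gamma>. \<Sum>(b, c)\<in>splittings \<delta>. (h a b c :: complex))"
proof -
  have "(\<Sum>p\<in>splittings \<gamma>. \<Sum>q\<in>splittings (fst p). h (fst q) (snd q) (snd p))
      = (\<Sum>(p, q)\<in>(SIGMA p:splittings \<gamma>. splittings (fst p)). h (fst q) (snd q) (snd p))"
    by (rule sum.Sigma) simp_all
  also have "\<dots> = (\<Sum>(p, q)\<in>(SIGMA p:splittings \<gamma>. splittings (snd p)). h (fst p) (fst q) (snd q))"
    by (rule sum.reindex_bij_witness
          [where i = "\<lambda>((a, \<delta>), (b, c)). ((a |\<union>| b, c), (a, b))"
             and j = "\<lambda>((\<delta>, c), (a, b)). ((a, b |\<union>| c), (b, c))"])
       (clarsimp simp: splittings_def inf_sup_distrib1 inf_sup_distrib2; (rule sup_assoc[symmetric] sup_assoc)?)+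
  also have "\<dots> = (\<Sum>p\<in>splittings \<gamma>. \<Sum>q\<in>splittings (snd p). h (fst p) (fst q) (snd q))"
    by (rule sum.Sigma[symmetric]) simp_all
  finally show ?thesis by (simp only: split_def)
qed

lemma grassmann_sign_assoc:
  assumes "(a, \<delta>) \<in> splittings \<gamma>" "(b, c) \<in> splittings \<delta>"
  shows "grassmann_sign a b * grassmann_sign (a |\<union>| b) c = grassmann_sign a \<delta> * grassmann_sign b c"
proof -
  have d: "a |\<inter>| b = {||}" "b |\<inter>| c = {||}" and \<delta>: "\<delta> = b |\<union>| c"
    using assms by (simp_all add: splittings_def, metis inf_sup_distrib1 sup_eq_bot_iff)
  show ?thesis
    unfolding grassmann_sign_def \<delta> inversions_union_left[OF d(1)] inversions_union_right[OF d(2)]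
    by (simp add: power_add)
qed

instantiation grassmann :: real_normed_algebra_1
begin

lift_definition one_grassmann :: grassmann is "\<lambda>\<alpha>. if \<alpha> = {||} then 1 else 0"
  by (rule summable_on_cong_neutral[THEN iffD1, OF _ _ _ summable_on_finite[of "{{||}}"]]) auto

lift_definition times_grassmann :: "grassmann \<Rightarrow> grassmann \<Rightarrow> grassmann" is
  "\<lambda>z w \<gamma>. \<Sum>(\<alpha>, \<beta>)\<in>splittings \<gamma>. grassmann_sign \<alpha> \<beta> * z \<alpha> * w \<beta>"
  by (rule abs_summable_UNIV_bounded(1)) (rule splittings_bounds)

instance
proof
  fix x y z :: grassmann and r :: real
  show "x * y * z = x * (y * z)"
    unfolding grassmann_eq_iff times_grassmann.rep_eq
  proof
    fix \<gamma>
    let ?h = "\<lambda>a b c. grassmann_sign a b * grassmann_sign (a |\<union>| b) c * gcoeff x a * gcoeff y b * gcoeff z c"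
    have "(\<Sum>(\<delta>, c)\<in>splittings \<gamma>. grassmann_sign \<delta> c *
             (\<Sum>(a, b)\<in>splittings \<delta>. grassmann_sign a b * gcoeff x a * gcoeff y b) * gcoeff z c)
        = (\<Sum>(\<delta>, c)\<in>splittings \<gamma>. \<Sum>(a, b)\<in>splittings \<delta>. ?h a b c)"
    proof (rule sum.cong[OF refl], clarify)
      fix \<delta> c
      show "grassmann_sign \<delta> c *
             (\<Sum>(a, b)\<in>splittings \<delta>. grassmann_sign a b * gcoeff x a * gcoeff y b) * gcoeff z c
        = (\<Sum>(a, b)\<in>splittings \<delta>. ?h a b c)"
        unfolding sum_distrib_left sum_distrib_right
        by (rule sum.cong) (auto simp: splittings_def)
    qed
    also have "\<dots> = (\<Sum>(a, \<delta>)\<in>splittings \<gamma>. \<Sum>(b, c)\<in>splittings \<delta>. ?h a b c)"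
      by (rule sum_splittings_assoc)
    also have "\<dots> = (\<Sum>(a, \<delta>)\<in>splittings \<gamma>. grassmann_sign a \<delta> * gcoeff x a *
             (\<Sum>(b, c)\<in>splittings \<delta>. grassmann_sign b c * gcoeff y b * gcoeff z c))"
    proof (rule sum.cong[OF refl], clarify)
      fix a \<delta> assume "(a, \<delta>) \<in> splittings \<gamma>"
      then show "(\<Sum>(b, c)\<in>splittings \<delta>. ?h a b c) = grassmann_sign a \<delta> * gcoeff x a *
             (\<Sum>(b, c)\<in>splittings \<delta>. grassmann_sign b c * gcoeff y b * gcoeff z c)"
        unfolding sum_distrib_left
        by (intro sum.cong refl) (clarsimp simp: grassmann_sign_assoc)
    qed
    finally show "(\<Sum>(\<alpha>, \<beta>)\<in>splittings \<gamma>. grassmann_sign \<alpha> \<beta> *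
             (\<Sum>(\<alpha>, \<beta>)\<in>splittings \<alpha>. grassmann_sign \<alpha> \<beta> * gcoeff x \<alpha> * gcoeff y \<beta>) * gcoeff z \<beta>)
        = (\<Sum>(\<alpha>, \<beta>)\<in>splittings \<gamma>. grassmann_sign \<alpha> \<beta> * gcoeff x \<alpha> *
             (\<Sum>(\<alpha>, \<beta>)\<in>splittings \<beta>. grassmann_sign \<alpha> \<beta> * gcoeff y \<alpha> * gcoeff z \<beta>))" .
  qed
  show "(x + y) * z = x * z + y * z" "x * (y + z) = x * y + x * z"
    by (auto simp: grassmann_eq_iff times_grassmann.rep_eq algebra_simps sum.distrib
        split_def)
  show "r *\<^sub>R x * y = r *\<^sub>R (x * y)" "x * r *\<^sub>R y = r *\<^sub>R (x * y)"
    by (auto simp: grassmann_eq_iff times_grassmann.rep_eq scaleR_sum_right split_def)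
  have "(\<Sum>(\<alpha>, \<beta>)\<in>splittings \<gamma>. grassmann_sign \<alpha> \<beta> * (if \<alpha> = {||} then 1 else 0) * gcoeff x \<beta>)
      = gcoeff x \<gamma>" for \<gamma>
    by (subst sum_splittings_single[where ?a0.0 = "{||}" and ?b0.0 = \<gamma>])
       (auto simp: splittings_def grassmann_sign_def inversions_def)
  then show "1 * x = x"
    by (simp add: grassmann_eq_iff times_grassmann.rep_eq one_grassmann.rep_eq)
  have "(\<Sum>(\<alpha>, \<beta>)\<in>splittings \<gamma>. grassmann_sign \<alpha> \<beta> * gcoeff x \<alpha> * (if \<beta> = {||} then 1 else 0))
      = gcoeff x \<gamma>" for \<gamma>
    by (subst sum_splittings_single[where ?a0.0 = \<gamma> and ?b0.0 = "{||}"])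
       (auto simp: splittings_def grassmann_sign_def inversions_def)
  then show "x * 1 = x"
    by (simp add: grassmann_eq_iff times_grassmann.rep_eq one_grassmann.rep_eq)
  show "(0::grassmann) \<noteq> 1"
    by (auto simp: grassmann_eq_iff one_grassmann.rep_eq intro!: exI[of _ "{||}"])
  have "norm (1::grassmann) = (\<Sum>\<^sub>\<infinity>\<alpha>\<in>{{||} :: nat fset}. 1)"
    unfolding norm_grassmann_def one_grassmann.rep_eq by (rule infsum_cong_neutral) auto
  then show "norm (1::grassmann) = 1" by simp
  show "norm (x * y) \<le> norm x * norm y"
    unfolding norm_grassmann_def times_grassmann.rep_eq
    by (rule abs_summable_UNIV_bounded(2)) (rule splittings_bounds[OF gcoeff_abs_summable gcoeff_abs_summable])
qed

end

lift_definition generator :: "nat \<Rightarrow> grassmann" is "\<lambda>n \<alpha>. if \<alpha> = {|n|} then 1 else 0"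
proof -
  fix n
  show "(\<lambda>\<alpha>. if \<alpha> = {|n|} then 1 else 0 :: complex) abs_summable_on UNIV"
    by (rule summable_on_cong_neutral[THEN iffD1, OF _ _ _ summable_on_finite[of "{{|n|}}"]]) auto
qed

lemma generator_anticommute: "generator n * generator m + generator m * generator n = 0"
proof -
  have prod: "gcoeff (generator n * generator m) \<gamma>
      = (if n \<noteq> m \<and> \<gamma> = {|n, m|} then grassmann_sign {|n|} {|m|} else 0)" for n m \<gamma>
  proof -
    have "gcoeff (generator n * generator m) \<gamma>
        = (if ({|n|}, {|m|}) \<in> splittings \<gamma> then grassmann_sign {|n|} {|m|} else 0)"
      unfolding times_grassmann.rep_eq generator.rep_eq
      by (subst sum_splittings_single[where ?a0.0 = "{|n|}" and ?b0.0 = "{|m|}"])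
         (simp_all split: if_splits)
    also have "({|n|}, {|m|}) \<in> splittings \<gamma> \<longleftrightarrow> n \<noteq> m \<and> \<gamma> = {|n, m|}"
      by (auto simp: splittings_def)
    finally show ?thesis .
  qed
  have inv: "inversions {|n|} {|m|} = (if m < n then 1 else 0)" for n m
  proof -
    have "{(a, b). a |\<in>| {|n|} \<and> b |\<in>| {|m|} \<and> b < a} = (if m < n then {(n, m)} else {})" by auto
    then show ?thesis by (simp add: inversions_def)
  qed
  show ?thesis
    by (auto simp: grassmann_eq_iff prod grassmann_sign_def inv finsert_commute)
qed

lift_definition dagger :: "grassmann \<Rightarrow> grassmann" is
  "\<lambda>z \<alpha>. (-1) ^ (fcard \<alpha> * (fcard \<alpha> - 1) div 2) * cnj (z \<alpha>)"
  by (simp add: norm_mult norm_power)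

lemma dagger_mult: "dagger (z * w) = dagger w * dagger z"
proof -
  let ?t = "\<lambda>k::nat. k * (k - 1) div 2"
  have tri: "?t (r + s) = ?t r + ?t s + r * s" for r s :: nat
  proof (induction r)
    case (Suc r)
    have step: "?t (Suc k) = ?t k + k" for k
    proof -
      have "Suc k * (Suc k - 1) = k * (k - 1) + 2 * k" by (cases k) auto
      then show ?thesis by simp
    qed
    show ?case using Suc step[of r] step[of "r + s"] by simp
  qed simp
  have sgn: "(-1) ^ ?t (fcard \<gamma>) * grassmann_sign \<alpha> \<beta>
      = grassmann_sign \<beta> \<alpha> * (-1) ^ ?t (fcard \<alpha>) * (-1) ^ ?t (fcard \<beta>)"
    if "(\<alpha>, \<beta>) \<in> splittings \<gamma>" for \<alpha> \<beta> \<gamma>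
  proof -
    have dis: "\<alpha> |\<inter>| \<beta> = {||}" and \<gamma>: "\<gamma> = \<alpha> |\<union>| \<beta>" using that by (auto simp: splittings_def)
    have card: "fcard \<gamma> = fcard \<alpha> + fcard \<beta>"
      unfolding \<gamma> by (rule fcard_funion_disjoint[OF dis])
    have "(-1::complex) ^ (inversions \<alpha> \<beta> + inversions \<alpha> \<beta>) = 1" by simp
    then show ?thesis
      unfolding card tri grassmann_sign_def inversions_swap[OF dis, symmetric]
      by (simp add: power_add algebra_simps)
  qed
  have "gcoeff (dagger (z * w)) \<gamma> = gcoeff (dagger w * dagger z) \<gamma>" for \<gamma>
  proof -
    have "gcoeff (dagger (z * w)) \<gamma> = (\<Sum>(\<alpha>, \<beta>)\<in>splittings \<gamma>.
        (-1) ^ ?t (fcard \<gamma>) * grassmann_sign \<alpha> \<beta> * cnj (gcoeff z \<alpha>) * cnj (gcoeff w \<beta>))"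
      unfolding dagger.rep_eq times_grassmann.rep_eq
      by (auto simp: sum_distrib_left split_def grassmann_sign_def mult_ac intro!: sum.cong)
    also have "\<dots> = (\<Sum>(\<alpha>, \<beta>)\<in>splittings \<gamma>.
        grassmann_sign \<beta> \<alpha> * ((-1) ^ ?t (fcard \<beta>) * cnj (gcoeff w \<beta>)) *
          ((-1) ^ ?t (fcard \<alpha>) * cnj (gcoeff z \<alpha>)))"
      using sgn by (intro sum.cong refl) (auto simp: mult_ac)
    also have "\<dots> = (\<Sum>(\<beta>, \<alpha>)\<in>splittings \<gamma>.
        grassmann_sign \<beta> \<alpha> * ((-1) ^ ?t (fcard \<beta>) * cnj (gcoeff w \<beta>)) *
          ((-1) ^ ?t (fcard \<alpha>) * cnj (gcoeff z \<alpha>)))"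
      by (rule sum.reindex_bij_witness[where i = prod.swap and j = prod.swap])
         (auto simp: splittings_def)
    finally show ?thesis by (simp add: dagger.rep_eq times_grassmann.rep_eq)
  qed
  then show ?thesis by (simp add: grassmann_eq_iff)
qed


section \<open>Matrices and power series\<close>

definition adjoint_mat :: "grassmann^'n^'m \<Rightarrow> grassmann^'m^'n" where
  "adjoint_mat M = (\<chi> j k. dagger (M $ k $ j))"

definition signature_matrix :: "grassmann^'p^'p \<Rightarrow> bool" where
  "signature_matrix J \<longleftrightarrow> J = adjoint_mat J \<and> J ** adjoint_mat J = mat 1"

text \<open>The library's power on \<open>'a^'n^'n\<close> is the entrywise one.\<close>

primrec mat_power :: "'a::semiring_1^'n^'n \<Rightarrow> nat \<Rightarrow> 'a^'n^'n" where
  "mat_power A 0 = mat 1"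
| "mat_power A (Suc n) = A ** mat_power A n"

definition observable :: "grassmann^'q^'p \<Rightarrow> grassmann^'q^'q \<Rightarrow> bool" where
  "observable C A \<longleftrightarrow> (\<Inter>u. {x. (C ** mat_power A u) *v x = 0}) = {0}"

definition lscale :: "'a::times \<Rightarrow> 'a^'n^'m \<Rightarrow> 'a^'n^'m" where
  "lscale c M = (\<chi> i j. c * M $ i $ j)"

definition rscale :: "'a::times^'n^'m \<Rightarrow> 'a \<Rightarrow> 'a^'n^'m" where
  "rscale M c = (\<chi> i j. M $ i $ j * c)"

text \<open>
  A power series with matrix coefficients is the sequence of its coefficients.  The products
  \<open>\<star>\<close> (powers of the variable on the left) and \<open>\<star>\<^sub>r\<close> (powers on the right) are the same
  convolution of coefficient sequences; they differ in the evaluation only.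
\<close>

definition star_prod :: "(nat \<Rightarrow> grassmann^'n^'m) \<Rightarrow> (nat \<Rightarrow> grassmann^'k^'n) \<Rightarrow> nat \<Rightarrow> grassmann^'k^'m"
    (infixl "\<star>" 70) where
  "(F \<star> G) n = (\<Sum>u\<le>n. F u ** G (n - u))"

definition const_series :: "grassmann^'n^'m \<Rightarrow> nat \<Rightarrow> grassmann^'n^'m" where
  "const_series M n = (if n = 0 then M else 0)"

definition linear_series :: "grassmann^'n^'m \<Rightarrow> grassmann^'n^'m \<Rightarrow> nat \<Rightarrow> grassmann^'n^'m" where
  "linear_series M N n = (if n = 0 then M else if n = 1 then N else 0)"

definition star_inv :: "(nat \<Rightarrow> grassmann^'n^'n) \<Rightarrow> nat \<Rightarrow> grassmann^'n^'n" where
  "star_inv F = (THE G. F \<star> G = const_series (mat 1) \<and> G \<star> F = const_series (mat 1))"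

definition eval_left :: "(nat \<Rightarrow> grassmann^'n^'m) \<Rightarrow> grassmann \<Rightarrow> grassmann^'n^'m" where
  "eval_left F z = (\<Sum>n. lscale (z ^ n) (F n))"

definition eval_right :: "(nat \<Rightarrow> grassmann^'n^'m) \<Rightarrow> grassmann \<Rightarrow> grassmann^'n^'m" where
  "eval_right F z = (\<Sum>n. rscale (F n) (z ^ n))"

text \<open>
  The \<open>\<star>\<close>-factor \<open>1 - z\<close> is the series \<open>I\<^sub>p - z I\<^sub>p\<close>; a constant matrix factor is a constant series.
\<close>

definition Theta_series ::
    "grassmann^'q^'q \<Rightarrow> grassmann^'q^'p \<Rightarrow> grassmann^'p^'p \<Rightarrow> grassmann^'q^'q \<Rightarrow> nat \<Rightarrow> grassmann^'p^'p" where
  "Theta_series A C J P =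
     const_series (mat 1)
       - linear_series (mat 1) (- mat 1) \<star> const_series C \<star> star_inv (linear_series (mat 1) (- A))
         \<star> const_series (matrix_inv P ** adjoint_mat (matrix_inv (mat 1 - A)) ** adjoint_mat C ** J)"

definition Theta ::
    "grassmann^'q^'q \<Rightarrow> grassmann^'q^'p \<Rightarrow> grassmann^'p^'p \<Rightarrow> grassmann^'q^'q
      \<Rightarrow> grassmann \<Rightarrow> grassmann^'p^'p" where
  "Theta A C J P z = eval_left (Theta_series A C J P) z"

text \<open>
  \<open>(I\<^sub>q - w A)\<^sup>* = I\<^sub>q - A\<^sup>* w\<^sup>\<dagger>\<close>, as a power series in \<open>w\<^sup>\<dagger>\<close> with powers on the right, has the
  adjoint coefficients.
\<close>

definition adjoint_series :: "(nat \<Rightarrow> grassmann^'n^'m) \<Rightarrow> nat \<Rightarrow> grassmann^'m^'n" where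
  "adjoint_series F n = adjoint_mat (F n)"

definition resolvent_kernel ::
    "grassmann^'q^'q \<Rightarrow> grassmann^'q^'p \<Rightarrow> grassmann^'q^'q \<Rightarrow> grassmann \<Rightarrow> grassmann \<Rightarrow> grassmann^'p^'p" where
  "resolvent_kernel A C P z w =
     eval_left (const_series C \<star> star_inv (linear_series (mat 1) (- A))) z
       ** matrix_inv P
       ** eval_right (star_inv (adjoint_series (linear_series (mat 1) (- A)))
            \<star> const_series (adjoint_mat C)) (dagger w)"

end

theory Submission
  imports Defs "HOL-Analysis.Analysis"
begin

text \<open>
  Let \<open>G(z) = \<Sum> z\<^sup>n C A\<^sup>n\<close>, which satisfies \<open>G(z) = C + z G(z) A\<close>.  Then
  \<open>\<Theta>(z) = I - \<delta>(z) V\<close> with \<open>\<delta>(z) = G(z) - z G(z)\<close>, the right-hand side is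
  \<open>K(z, w) = G(z) P\<^sup>-\<^sup>1 G(w)\<^sup>*\<close>, and pure algebra gives
  \<open>J - \<Theta>(z) J \<Theta>(w)\<^sup>* = K(z, w) - z K(z, w) w\<^sup>\<dagger> + \<delta>(z) X \<delta>(w)\<^sup>*\<close>
  for a constant matrix \<open>X\<close> that vanishes iff the Stein equation holds.  If \<open>X = 0\<close>, the sum
  telescopes to \<open>K\<close>.  Conversely, a sum with value \<open>K\<close> forces
  \<open>J - \<Theta>(z) J \<Theta>(w)\<^sup>* = K(z, w) - z K(z, w) w\<^sup>\<dagger>\<close>, so \<open>\<delta>(z) X \<delta>(w)\<^sup>* = 0\<close>; for small real
  \<open>z\<close> and \<open>w\<close> this is \<open>G(z) X G(w)\<^sup>* = 0\<close>, and observability, applied once on each side,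
  gives \<open>X = 0\<close>.
\<close>

subsection \<open>Matrices over a noncommutative ring\<close>

lemma matrix_mul_add_rdistrib:
  fixes B :: "'a::semiring_1^'n^'m"
  shows "(B + C) ** D = B ** D + C ** D"
  by (simp add: vec_eq_iff matrix_matrix_mult_def sum.distrib algebra_simps)

lemma matrix_mul_diff_distrib:
  fixes A :: "'a::ring_1^'n^'m"
  shows "A ** (B - C) = A ** B - A ** C" "(B - C) ** D = B ** D - C ** D"
  by (simp_all add: vec_eq_iff matrix_matrix_mult_def sum_subtractf algebra_simps)

lemma matrix_mul_minus:
  fixes A :: "'a::ring_1^'n^'m"
  shows "A ** (- B) = - (A ** B)" "(- A) ** B = - (A ** B)"
  by (simp_all add: vec_eq_iff matrix_matrix_mult_def sum_negf)

lemmas matrix_distrib = matrix_add_ldistrib matrix_mul_add_rdistrib matrix_mul_diff_distrib matrix_mul_minus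

lemma matrix_inv_props:
  assumes "invertible A"
  shows "A ** matrix_inv A = mat 1" "matrix_inv A ** A = mat 1"
  using someI_ex[OF assms[unfolded invertible_def]] by (simp_all add: matrix_inv_def)

lemma mat_power_commute: "mat_power A n ** A = A ** mat_power A n"
  by (induction n) (simp_all flip: matrix_mul_assoc)

lemma lscale_diff: "lscale c (M - N :: 'a::ring_1^'n^'m) = lscale c M - lscale c N"
  by (simp add: lscale_def vec_eq_iff right_diff_distrib)

lemma lscale_minus: "lscale c (- M :: 'a::ring_1^'n^'m) = - lscale c M"
  by (simp add: lscale_def vec_eq_iff)

lemma rscale_diff: "rscale (M - N :: 'a::ring_1^'n^'m) c = rscale M c - rscale N c"
  by (simp add: rscale_def vec_eq_iff left_diff_distrib)

text \<open>Scalars do not commute with matrix entries, so a left scalar can leave only the left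
  factor of a product and a right scalar, in \<open>rscale_matrix_mul\<close>, only the right
  factor.\<close>

lemma lscale_matrix_mul: "lscale (c :: 'a::semiring_1) M ** N = lscale c (M ** N)"
  by (simp add: lscale_def vec_eq_iff matrix_matrix_mult_def sum_distrib_left mult.assoc)

lemma rscale_matrix_mul: "M ** rscale N (c :: 'a::semiring_1) = rscale (M ** N) c"
  by (simp add: rscale_def vec_eq_iff matrix_matrix_mult_def sum_distrib_right mult.assoc)

lemma lscale_lscale: "lscale a (lscale (b :: 'a::semiring_1) M) = lscale (a * b) M"
  by (simp add: lscale_def mult.assoc)

lemma rscale_rscale: "rscale (rscale M a) (b :: 'a::semiring_1) = rscale M (a * b)"
  by (simp add: rscale_def mult.assoc)

lemma lscale_rscale: "lscale a (rscale M (b :: 'a::semiring_1)) = rscale (lscale a M) b"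
  by (simp add: lscale_def rscale_def mult.assoc)

lemma lscale_1: "lscale (1 :: 'a::semiring_1) M = M" and rscale_1: "rscale M (1 :: 'a) = M"
  by (simp_all add: lscale_def rscale_def vec_eq_iff)

text \<open>Real scalars are central; this is what makes evaluation at real points convenient in the
  converse direction.\<close>

lemma lscale_of_real: "lscale (of_real t :: 'a::real_algebra_1) M = t *\<^sub>R M"
  by (simp add: lscale_def vec_eq_iff of_real_def)

subsection \<open>Conjugation and adjoints\<close>

text \<open>The sign depends only on the cardinality of the index, so applying it twice squares it
  to 1.\<close>

lemma dagger_dagger: "dagger (dagger z) = z"
proof -
  have "(- 1 :: complex) ^ k * ((- 1) ^ k * x) = x" for k x
    by (simp flip: mult.assoc power_add)
  then show ?thesis by (simp add: grassmann_eq_iff dagger.rep_eq)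
qed

lemma dagger_add: "dagger (x + y) = dagger x + dagger y"
  by (simp add: grassmann_eq_iff dagger.rep_eq algebra_simps)

lemma norm_dagger: "norm (dagger z) = norm z"
  by (simp add: norm_grassmann_def dagger.rep_eq norm_mult norm_power)

text \<open>Conjugation is conjugate-linear over the complex numbers but linear over the reals,
  which is enough to carry it through infinite sums.\<close>

lemma bounded_linear_dagger: "bounded_linear dagger"
  by (rule bounded_linear_intro[where K = 1])
    (simp_all add: dagger_add norm_dagger grassmann_eq_iff dagger.rep_eq)

lemmas linear_dagger = bounded_linear.linear[OF bounded_linear_dagger]

lemmas dagger_linear_simps = linear_0[OF linear_dagger] linear_neg[OF linear_dagger]
  linear_diff[OF linear_dagger] linear_scale[OF linear_dagger] linear_sum[OF linear_dagger]

lemma dagger_1: "dagger 1 = 1"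
  by (simp add: grassmann_eq_iff dagger.rep_eq one_grassmann.rep_eq fcard_fempty)

lemma dagger_power: "dagger (z ^ n) = dagger z ^ n"
  by (induction n) (simp_all add: dagger_1 dagger_mult power_commutes)

lemma adjoint_adjoint: "adjoint_mat (adjoint_mat M) = M"
  by (simp add: adjoint_mat_def dagger_dagger vec_eq_iff)

lemma adjoint_0: "adjoint_mat 0 = 0"
  by (simp add: adjoint_mat_def dagger_linear_simps vec_eq_iff)

lemma adjoint_diff: "adjoint_mat (M - N) = adjoint_mat M - adjoint_mat N"
  by (simp add: adjoint_mat_def dagger_linear_simps vec_eq_iff)

lemma adjoint_minus: "adjoint_mat (- M) = - adjoint_mat M"
  by (simp add: adjoint_mat_def dagger_linear_simps vec_eq_iff)

lemma adjoint_scaleR: "adjoint_mat (r *\<^sub>R M) = r *\<^sub>R adjoint_mat M"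
  by (simp add: adjoint_mat_def dagger_linear_simps vec_eq_iff)

lemma adjoint_mat_1: "adjoint_mat (mat 1) = mat 1"
  by (simp add: adjoint_mat_def mat_def dagger_1 dagger_linear_simps vec_eq_iff)

lemma adjoint_mult: "adjoint_mat (M ** N) = adjoint_mat N ** adjoint_mat M"
  by (simp add: adjoint_mat_def matrix_matrix_mult_def dagger_linear_simps dagger_mult vec_eq_iff)

text \<open>Conjugation reverses products, so powers of z on the left become powers of
  \<open>dagger z\<close> on the right. This links \<open>eval_left\<close> and
  \<open>eval_right\<close>.\<close>

lemma adjoint_lscale: "adjoint_mat (lscale c M) = rscale (adjoint_mat M) (dagger c)"
  by (simp add: adjoint_mat_def lscale_def rscale_def dagger_mult vec_eq_iff)

lemma adjoint_mat_power: "adjoint_mat (mat_power A n) = mat_power (adjoint_mat A) n"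
  by (induction n) (simp_all add: adjoint_mat_1 adjoint_mult mat_power_commute)

subsection \<open>Power series with matrix coefficients\<close>

text \<open>Only the indices 0 and 1 of the convolution contribute. The case n = 0 is separate
  because \<open>F (n - 1)\<close> would then be \<open>F 0\<close>.\<close>

lemma linear_series_star:
  "(linear_series M N \<star> F) n = M ** F n + (if n = 0 then 0 else N ** F (n - 1))"
proof (cases n)
  case (Suc k)
  have "(linear_series M N \<star> F) n = (\<Sum>u\<in>{0, 1}. linear_series M N u ** F (n - u))"
    unfolding star_prod_def
    by (rule sum.mono_neutral_right) (auto simp: linear_series_def Suc)
  then show ?thesis by (simp add: linear_series_def Suc)
qed (simp add: star_prod_def linear_series_def)

lemma star_linear_series:
  "(F \<star> linear_series M N) n = F n ** M + (if n = 0 then 0 else F (n - 1) ** N)"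
proof (cases n)
  case (Suc k)
  have "(F \<star> linear_series M N) n = (\<Sum>u\<in>{n, k}. F u ** linear_series M N (n - u))"
    unfolding star_prod_def
    by (rule sum.mono_neutral_right) (auto simp: linear_series_def Suc)
  then show ?thesis by (simp add: linear_series_def Suc)
qed (simp add: star_prod_def linear_series_def)

lemma const_series_linear: "const_series M = linear_series M 0"
  by (auto simp: const_series_def linear_series_def)

lemma const_series_star: "(const_series M \<star> F) n = M ** F n"
  by (simp add: const_series_linear linear_series_star)

lemma star_const_series: "(F \<star> const_series M) n = F n ** M"
  by (simp add: const_series_linear star_linear_series)

text \<open>The geometric series is a two-sided inverse. It is the only one, because already the
  equation for a right inverse is a recursion that fixes every coefficient.\<close>

lemma star_inv_linear_series: "star_inv (linear_series (mat 1) (- A)) = mat_power A"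
  unfolding star_inv_def
proof (rule the_equality)
  have "mat_power A n - A ** mat_power A (n - 1) = 0" if "n \<noteq> 0" for n
    using that by (cases n) simp_all
  then show "linear_series (mat 1) (- A) \<star> mat_power A = const_series (mat 1)
      \<and> mat_power A \<star> linear_series (mat 1) (- A) = const_series (mat 1)"
    by (auto simp: fun_eq_iff linear_series_star star_linear_series const_series_def matrix_mul_minus
        mat_power_commute)
next
  fix G assume "linear_series (mat 1) (- A) \<star> G = const_series (mat 1)
      \<and> G \<star> linear_series (mat 1) (- A) = const_series (mat 1)"
  then have G: "G n + (if n = 0 then 0 else - A ** G (n - 1)) = const_series (mat 1) n" for n
    using linear_series_star[of "mat 1" "- A" G n] by simp
  have "G n = mat_power A n" for n
  proof (induction n)
    case 0
    show ?case using G[of 0] by (simp add: const_series_def)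
  next
    case (Suc n)
    then show ?case using G[of "Suc n"] by (simp add: const_series_def matrix_mul_minus)
  qed
  then show "G = mat_power A" by (rule ext)
qed

lemma adjoint_linear_series:
  "adjoint_series (linear_series M N) = linear_series (adjoint_mat M) (adjoint_mat N)"
  by (auto simp: adjoint_series_def linear_series_def adjoint_0 fun_eq_iff)

lemma sums_matrix_iff:
  fixes F :: "nat \<Rightarrow> 'a::real_normed_vector^'n^'m"
  shows "F sums M \<longleftrightarrow> (\<forall>i j. (\<lambda>n. F n $ i $ j) sums M $ i $ j)"
proof
  assume "F sums M"
  then show "\<forall>i j. (\<lambda>n. F n $ i $ j) sums M $ i $ j"
    by (intro allI bounded_linear.sums[OF bounded_linear_vec_nth])
next
  assume "\<forall>i j. (\<lambda>n. F n $ i $ j) sums M $ i $ j"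
  then show "F sums M"
    unfolding sums_def by (intro vec_tendstoI) simp
qed

lemma sums_lscale:
  fixes M :: "'a::real_normed_algebra^'n^'m"
  shows "F sums M \<Longrightarrow> (\<lambda>n. lscale c (F n)) sums lscale c M"
  by (simp add: sums_matrix_iff lscale_def sums_mult)

lemma sums_rscale:
  fixes M :: "'a::real_normed_algebra^'n^'m"
  shows "F sums M \<Longrightarrow> (\<lambda>n. rscale (F n) c) sums rscale M c"
  by (simp add: sums_matrix_iff rscale_def sums_mult2)

lemma sums_matrix_mul_right:
  fixes M :: "'a::real_normed_algebra_1^'n^'m"
  shows "F sums M \<Longrightarrow> (\<lambda>n. F n ** N) sums (M ** N)"
  by (simp add: sums_matrix_iff matrix_matrix_mult_def sums_mult2 sums_sum)

lemma sums_adjoint: "F sums M \<Longrightarrow> (\<lambda>n. adjoint_mat (F n)) sums adjoint_mat M"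
  by (simp add: sums_matrix_iff adjoint_mat_def bounded_linear.sums[OF bounded_linear_dagger])

subsection \<open>The resolvent series\<close>

text \<open>This is G(z), with the \<star>-inverse already expanded into its geometric
  series.\<close>

definition resolvent :: "grassmann^'q^'q \<Rightarrow> grassmann^'q^'p \<Rightarrow> grassmann \<Rightarrow> grassmann^'q^'p" where
  "resolvent A C z = eval_left (\<lambda>n. C ** mat_power A n) z"

text \<open>For this norm, geometric bounds on the entries of powers follow from the triangle
  inequality alone.\<close>

definition entry_norm :: "'a::real_normed_vector^'n^'m \<Rightarrow> real" where
  "entry_norm M = (\<Sum>i\<in>UNIV. \<Sum>j\<in>UNIV. norm (M $ i $ j))"

lemma entry_norm_nonneg: "0 \<le> entry_norm M"
  by (simp add: entry_norm_def sum_nonneg)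

lemma row_norm_le_entry_norm: "(\<Sum>j\<in>UNIV. norm (M $ i $ j)) \<le> entry_norm M"
  unfolding entry_norm_def by (rule member_le_sum) (simp_all add: sum_nonneg)

text \<open>Fixing the column j lets the induction over matrix powers vary the row only.\<close>

lemma norm_matrix_mul_entry_le:
  fixes M :: "'a::real_normed_algebra_1^'n^'m"
  assumes "\<And>k. norm (N $ k $ j) \<le> b" "0 \<le> b"
  shows "norm ((M ** N) $ i $ j) \<le> entry_norm M * b"
proof -
  have "norm ((M ** N) $ i $ j) \<le> (\<Sum>k\<in>UNIV. norm (M $ i $ k) * b)"
    unfolding matrix_matrix_mult_def vec_lambda_beta
    by (intro sum_norm_le order.trans[OF norm_mult_ineq] mult_left_mono assms(1)) simp
  also have "\<dots> \<le> entry_norm M * b"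
    unfolding sum_distrib_right[symmetric]
    by (rule mult_right_mono[OF row_norm_le_entry_norm assms(2)])
  finally show ?thesis .
qed

lemma norm_mat_power_entry_le:
  "norm (mat_power (A :: 'a::real_normed_algebra_1^'n^'n) n $ i $ j) \<le> entry_norm A ^ n"
proof (induction n arbitrary: i)
  case 0
  show ?case by (simp add: mat_def)
next
  case (Suc n)
  show ?case
    using norm_matrix_mul_entry_le[of "mat_power A n" j "entry_norm A ^ n" A i] Suc
    by (simp add: entry_norm_nonneg)
qed

text \<open>The threshold 1/2 yields a majorant that does not depend on z, and hence a uniform bound
  on the sum.\<close>

lemma resolvent_term_bound:
  fixes A :: "grassmann^'q^'q" and C :: "grassmann^'q^'p"
  assumes "norm z * entry_norm A \<le> 1/2"
  shows "norm (lscale (z ^ n) (C ** mat_power A n) $ i $ j) \<le> entry_norm C * (1/2) ^ n"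
proof -
  have "norm (lscale (z ^ n) (C ** mat_power A n) $ i $ j)
      \<le> norm z ^ n * (entry_norm C * entry_norm A ^ n)"
    unfolding lscale_def vec_lambda_beta
    by (intro order.trans[OF norm_mult_ineq] mult_mono norm_power_ineq norm_matrix_mul_entry_le
        norm_mat_power_entry_le) (simp_all add: entry_norm_nonneg)
  also have "\<dots> = entry_norm C * (norm z * entry_norm A) ^ n"
    by (simp add: power_mult_distrib)
  also have "\<dots> \<le> entry_norm C * (1/2) ^ n"
    by (intro mult_left_mono power_mono assms) (simp_all add: entry_norm_nonneg)
  finally show ?thesis .
qed

lemma resolvent_sums:
  fixes A :: "grassmann^'q^'q" and C :: "grassmann^'q^'p"
  assumes z: "norm z * entry_norm A \<le> 1/2"
  shows "(\<lambda>n. lscale (z ^ n) (C ** mat_power A n)) sums resolvent A C z"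
    and "norm (resolvent A C z $ i $ j) \<le> 2 * entry_norm C"
proof -
  let ?f = "\<lambda>n. lscale (z ^ n) (C ** mat_power A n)"
  have half: "(\<lambda>n. entry_norm C * (1/2) ^ n) sums (2 * entry_norm C)"
    using sums_mult[OF geometric_sums[of "1/2 :: real"], of "entry_norm C"]
    by (simp add: mult.commute)
  have "summable (\<lambda>n. ?f n $ i $ j)" for i j
    by (rule summable_comparison_test'[OF sums_summable[OF half]])
       (rule resolvent_term_bound[OF z])
  then have "?f sums (\<chi> i j. \<Sum>n. ?f n $ i $ j)"
    by (simp add: sums_matrix_iff summable_sums)
  then show *: "?f sums resolvent A C z"
    by (simp add: resolvent_def eval_left_def sums_iff)
  then have "resolvent A C z $ i $ j = (\<Sum>n. ?f n $ i $ j)"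
    by (simp add: sums_matrix_iff sums_iff)
  also have "norm \<dots> \<le> (\<Sum>n. entry_norm C * (1/2) ^ n)"
    by (rule norm_suminf_le[OF resolvent_term_bound[OF z] sums_summable[OF half]])
  also have "\<dots> = 2 * entry_norm C"
    by (rule sums_unique[OF half, symmetric])
  finally show "norm (resolvent A C z $ i $ j) \<le> 2 * entry_norm C" .
qed

text \<open>Term n + 1 is z times term n times \<open>A\<close>. Since z need not commute with the
  entries of \<open>C\<close> and \<open>A\<close>, this equation takes the place of a closed form
  for the sum.\<close>

lemma resolvent_eq:
  assumes "norm z * entry_norm A \<le> 1/2"
  shows "resolvent A C z = C + lscale z (resolvent A C z) ** A"
proof -
  let ?f = "\<lambda>n. lscale (z ^ n) (C ** mat_power A n)"
  have "(\<lambda>n. lscale z (?f n) ** A) sums (lscale z (resolvent A C z) ** A)"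
    by (intro sums_matrix_mul_right sums_lscale resolvent_sums assms)
  also have "(\<lambda>n. lscale z (?f n) ** A) = (\<lambda>n. ?f (Suc n))"
    by (simp add: lscale_matrix_mul lscale_lscale mat_power_commute flip: matrix_mul_assoc)
  finally have "?f sums (lscale z (resolvent A C z) ** A + ?f 0)"
    by (rule sums_Suc)
  then have "resolvent A C z = lscale z (resolvent A C z) ** A + ?f 0"
    by (rule sums_unique2[OF resolvent_sums(1)[OF assms]])
  also have "\<dots> = C + lscale z (resolvent A C z) ** A"
    by (simp add: lscale_1 add.commute)
  finally show ?thesis .
qed

lemma Theta_eq:
  assumes "norm z * entry_norm A \<le> 1/2"
  shows "Theta A C J P z = mat 1 - (resolvent A C z - lscale z (resolvent A C z))
           ** (matrix_inv P ** adjoint_mat (matrix_inv (mat 1 - A)) ** adjoint_mat C ** J)"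
    (is "_ = mat 1 - _ ** ?V")
proof -
  let ?f = "\<lambda>n. lscale (z ^ n) (C ** mat_power A n)"
  \<comment> \<open>The series of z G(z), shifted by one place; its term at 0 is 0 because the first
    term of G has no predecessor.\<close>
  let ?g = "\<lambda>n. if n = 0 then 0 else lscale z (?f (n - 1))"
  have lin: "linear_series (mat 1) (- mat 1) \<star> const_series C = linear_series C (- C)"
    by (auto simp: fun_eq_iff star_const_series linear_series_def matrix_mul_minus)
  have coeff: "Theta_series A C J P n = const_series (mat 1) n
      - (C ** mat_power A n - (if n = 0 then 0 else C ** mat_power A (n - 1))) ** ?V" for n
    by (simp add: Theta_series_def lin star_const_series linear_series_star star_inv_linear_series
        matrix_mul_minus)
  have terms: "lscale (z ^ n) (Theta_series A C J P n)
      = (if n = 0 then mat 1 else 0) - (?f n - ?g n) ** ?V" for n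
  proof (cases n)
    case 0
    then show ?thesis by (simp add: coeff const_series_def lscale_1)
  next
    case (Suc k)
    then show ?thesis
      by (simp add: coeff const_series_def matrix_distrib lscale_diff lscale_minus lscale_lscale
          lscale_matrix_mul)
  qed
  have "?g sums (lscale z (resolvent A C z) + ?g 0)"
    by (rule sums_Suc) (simp add: sums_lscale resolvent_sums(1)[OF assms])
  then have g: "?g sums lscale z (resolvent A C z)" by simp
  have "(\<lambda>n. lscale (z ^ n) (Theta_series A C J P n))
      sums (mat 1 - (resolvent A C z - lscale z (resolvent A C z)) ** ?V)"
    unfolding terms
    by (intro sums_diff sums_matrix_mul_right resolvent_sums(1)[OF assms] g)
       (rule sums_single[of 0 "\<lambda>_. mat 1"])
  then show ?thesis by (simp add: Theta_def eval_left_def sums_iff)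
qed

text \<open>Taking adjoints term by term in the series of G(w) gives exactly the right-evaluated
  series in \<open>dagger w\<close>.\<close>

lemma resolvent_kernel_eq:
  assumes "norm w * entry_norm A \<le> 1/2"
  shows "resolvent_kernel A C P z w
    = resolvent A C z ** matrix_inv P ** adjoint_mat (resolvent A C w)"
proof -
  have "(\<lambda>n. adjoint_mat (lscale (w ^ n) (C ** mat_power A n))) sums adjoint_mat (resolvent A C w)"
    by (intro sums_adjoint resolvent_sums assms)
  then have "eval_right (\<lambda>n. mat_power (adjoint_mat A) n ** adjoint_mat C) (dagger w)
      = adjoint_mat (resolvent A C w)"
    by (simp add: eval_right_def adjoint_lscale adjoint_mult adjoint_mat_power dagger_power sums_iff)
  moreover have "(star_inv (adjoint_series (linear_series (mat 1) (- A))) \<star> const_series (adjoint_mat C))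
      = (\<lambda>n. mat_power (adjoint_mat A) n ** adjoint_mat C)"
    by (simp add: fun_eq_iff star_const_series adjoint_linear_series adjoint_minus adjoint_mat_1
        star_inv_linear_series)
  moreover have "const_series C \<star> star_inv (linear_series (mat 1) (- A)) = (\<lambda>n. C ** mat_power A n)"
    by (simp add: fun_eq_iff const_series_star star_inv_linear_series)
  ultimately show ?thesis
    by (simp add: resolvent_kernel_def resolvent_def)
qed

text \<open>Observability speaks of vectors; it is applied to each column of
  \<open>Y\<close>.\<close>

lemma observable_cancel:
  assumes "observable C A" and "\<And>u. C ** mat_power A u ** Y = 0"
  shows "Y = 0"
proof -
  have "(\<chi> k. Y $ k $ j) = 0" for j
  proof -
    have "(C ** mat_power A u) *v (\<chi> k. Y $ k $ j) = 0" for u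
    proof -
      have "(C ** mat_power A u ** Y) $ i $ j = 0" for i
        by (simp add: assms(2))
      then show ?thesis
        by (simp add: vec_eq_iff matrix_vector_mult_def matrix_matrix_mult_def[of "C ** mat_power A u"])
    qed
    then show ?thesis using assms(1) unfolding observable_def by blast
  qed
  then show ?thesis by (simp add: vec_eq_iff)
qed

text \<open>Instead of comparing coefficients, let \<open>t \<rightarrow> 0\<close> repeatedly in \<open>G(t) = C + t G(t) A\<close>.\<close>

lemma resolvent_cancel:
  fixes A :: "grassmann^'q^'q" and C :: "grassmann^'q^'p" and Y :: "grassmann^'k^'q"
  assumes obs: "observable C A" and "0 < r" and r: "r * entry_norm A \<le> 1/2"
    and zero: "\<And>t. 0 < t \<Longrightarrow> t < r \<Longrightarrow> resolvent A C (of_real t) ** Y = 0"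
  shows "Y = 0"
proof -
  have small: "norm (of_real t :: grassmann) * entry_norm A \<le> 1/2" if "0 < t" "t < r" for t
    using mult_right_mono[of t r "entry_norm A"] that r by (simp add: entry_norm_nonneg)
  \<comment> \<open>G(t) is bounded uniformly for small t, so the factor t forces the limit
    0.\<close>
  have lim: "((\<lambda>t. t *\<^sub>R (resolvent A C (of_real t) ** Z)) \<longlongrightarrow> 0) (at_right 0)"
    for Z :: "grassmann^'k^'q"
  proof (intro vec_tendstoI)
    fix i j
    have t0: "((\<lambda>t::real. t * (2 * entry_norm C)) \<longlongrightarrow> 0) (at_right 0)"
      by (rule tendsto_eq_intros refl)+ simp
    have "((\<lambda>t. t *\<^sub>R resolvent A C (of_real t) $ i $ k) \<longlongrightarrow> 0) (at_right 0)" for k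
    proof (rule Lim_null_comparison[OF _ t0])
      show "\<forall>\<^sub>F t in at_right 0.
          norm (t *\<^sub>R resolvent A C (of_real t) $ i $ k) \<le> t * (2 * entry_norm C)"
        unfolding eventually_at_right_field
      proof (intro exI[of _ r] conjI allI impI)
        fix t :: real assume "0 < t" "t < r"
        then show "norm (t *\<^sub>R resolvent A C (of_real t) $ i $ k) \<le> t * (2 * entry_norm C)"
          using resolvent_sums(2)[OF small] by (simp add: mult_left_mono)
      qed (rule \<open>0 < r\<close>)
    qed
    then have "((\<lambda>t. \<Sum>k\<in>UNIV. (t *\<^sub>R resolvent A C (of_real t) $ i $ k) * Z $ k $ j) \<longlongrightarrow> 0) (at_right 0)"
      by (intro tendsto_null_sum tendsto_mult_left_zero)
    then show "((\<lambda>t. (t *\<^sub>R (resolvent A C (of_real t) ** Z)) $ i $ j) \<longlongrightarrow> 0 $ i $ j) (at_right 0)"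
      by (simp add: matrix_matrix_mult_def scaleR_sum_right)
  qed
  have rec: "resolvent A C (of_real t) ** Z
      = C ** Z + t *\<^sub>R (resolvent A C (of_real t) ** (A ** Z))"
    if "0 < t" "t < r" for t and Z :: "grassmann^'k^'q"
  proof -
    have "resolvent A C (of_real t) ** Z
        = (C + lscale (of_real t) (resolvent A C (of_real t)) ** A) ** Z"
      by (rule arg_cong[OF resolvent_eq[OF small[OF that]], of "\<lambda>M. M ** Z"])
    then show ?thesis
      by (simp add: matrix_distrib lscale_matrix_mul lscale_of_real scalar_matrix_assoc
          flip: matrix_mul_assoc)
  qed
  \<comment> \<open>If G(t) \<open>Z\<close> vanishes, the recursion says that t G(t)
    \<open>A ** Z\<close> is the constant \<open>- (C ** Z)\<close>; its limit at 0 is 0.\<close>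
  have CZ: "C ** Z = 0" if Z: "\<And>t. 0 < t \<Longrightarrow> t < r \<Longrightarrow> resolvent A C (of_real t) ** Z = 0"
    for Z :: "grassmann^'k^'q"
  proof -
    have "((\<lambda>t::real. - (C ** Z)) \<longlongrightarrow> 0) (at_right 0)"
    proof (rule Lim_transform_eventually[OF lim[of "A ** Z"]])
      show "\<forall>\<^sub>F t in at_right 0. t *\<^sub>R (resolvent A C (of_real t) ** (A ** Z)) = - (C ** Z)"
        unfolding eventually_at_right_field
        using rec Z \<open>0 < r\<close> by (metis eq_neg_iff_add_eq_0 add.commute)
    qed
    then show ?thesis by (simp add: tendsto_const_iff)
  qed
  \<comment> \<open>Once the constant term is known to vanish, dividing the recursion by t passes
    from \<open>mat_power A n\<close> to the next power.\<close>
  have "resolvent A C (of_real t) ** (mat_power A n ** Y) = 0" if "0 < t" "t < r" for n t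
    using that
  proof (induction n arbitrary: t)
    case 0
    then show ?case using zero by simp
  next
    case (Suc n)
    then have "t *\<^sub>R (resolvent A C (of_real t) ** (A ** (mat_power A n ** Y))) = 0"
      using rec[of t "mat_power A n ** Y"] CZ[of "mat_power A n ** Y"] by simp
    then show ?case using Suc.prems by (simp add: matrix_mul_assoc)
  qed
  then show ?thesis
    by (intro observable_cancel[OF obs]) (simp add: CZ flip: matrix_mul_assoc)
qed

subsection \<open>The algebraic identities\<close>

text \<open>Multiply on the left by \<open>(mat 1 - A') ** P\<close> and on the right by
  \<open>P ** (mat 1 - A)\<close>. Both are invertible, with inverses \<open>R ** S'\<close> and
  \<open>S ** R\<close>, so the step can be reversed. \<open>A'\<close> and \<open>S'\<close> stand
  for the adjoints of \<open>A\<close> and \<open>S\<close>.\<close>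

lemma Stein_equation_iff:
  fixes A A' P R S S' Q :: "'a::ring_1^'n^'n"
  assumes S: "(mat 1 - A) ** S = mat 1" "S ** (mat 1 - A) = mat 1"
    and S': "(mat 1 - A') ** S' = mat 1" "S' ** (mat 1 - A') = mat 1"
    and R: "P ** R = mat 1" "R ** P = mat 1"
  shows "S ** R + R ** S' - R = R ** S' ** Q ** S ** R \<longleftrightarrow> P - A' ** P ** A = Q"
proof -
  let ?l = "(mat 1 - A') ** P" and ?r = "P ** (mat 1 - A)"
  have l: "?l ** (R ** S' ** M) = M" "R ** S' ** (?l ** M) = M" for M :: "'a^'n^'n"
  proof -
    have "?l ** (R ** S' ** M) = (mat 1 - A') ** (P ** R) ** S' ** M" by (simp add: matrix_mul_assoc)
    then show "?l ** (R ** S' ** M) = M" by (simp add: R S')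
    have "R ** S' ** (?l ** M) = R ** (S' ** (mat 1 - A')) ** P ** M" by (simp add: matrix_mul_assoc)
    then show "R ** S' ** (?l ** M) = M" by (simp add: R S')
  qed
  have r: "M ** S ** R ** ?r = M" "M ** ?r ** S ** R = M" for M :: "'a^'n^'n"
  proof -
    have "M ** S ** R ** ?r = M ** S ** (R ** P) ** (mat 1 - A)" by (simp add: matrix_mul_assoc)
    then show "M ** S ** R ** ?r = M" by (simp add: R S flip: matrix_mul_assoc)
    have "M ** ?r ** S ** R = M ** P ** ((mat 1 - A) ** S) ** R" by (simp add: matrix_mul_assoc)
    then show "M ** ?r ** S ** R = M" by (simp add: R S flip: matrix_mul_assoc)
  qed
  have "?l ** (S ** R + R ** S' - R) ** ?r = ?l + ?r - ?l ** R ** ?r"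
    using l(1)[of "mat 1"] r(1)[of ?l] by (simp add: matrix_distrib matrix_mul_assoc)
  also have "?l ** R ** ?r = (mat 1 - A') ** (P ** R) ** P ** (mat 1 - A)"
    by (simp only: matrix_mul_assoc)
  also have "?l + ?r - \<dots> = P - A' ** P ** A"
    by (simp add: R matrix_distrib matrix_mul_assoc)
  finally have eq: "?l ** (S ** R + R ** S' - R) ** ?r = P - A' ** P ** A" .
  have Q: "?l ** (R ** S' ** Q ** S ** R) ** ?r = Q"
  proof -
    have "?l ** (R ** S' ** Q ** S ** R) ** ?r = ?l ** (R ** S' ** Q) ** S ** R ** ?r"
      by (simp add: matrix_mul_assoc)
    then show ?thesis unfolding l r .
  qed
  have inj: "M = N" if "?l ** M ** ?r = ?l ** N ** ?r" for M N :: "'a^'n^'n"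
  proof -
    have cancel: "R ** S' ** (?l ** M ** ?r) ** S ** R = M" for M :: "'a^'n^'n"
      using l(2)[of "M ** ?r"] r(2)[of M] by (simp add: matrix_mul_assoc)
    show ?thesis
      using cancel[of M] unfolding that cancel by (rule sym)
  qed
  show ?thesis
  proof
    assume "S ** R + R ** S' - R = R ** S' ** Q ** S ** R"
    then show "P - A' ** P ** A = Q" using eq Q by (simp only:)
  next
    assume "P - A' ** P ** A = Q"
    then show "S ** R + R ** S' - R = R ** S' ** Q ** S ** R"
      by (rule inj[OF trans[OF eq trans[OF _ Q[symmetric]]]])
  qed
qed

text \<open>Here d is \<delta>(z), e is z G(z), so d + e is G(z), and \<open>B\<close> is I - A;
  primes mark the adjoints on the side of w. The hypotheses on e and e' turn \<open>C ** S\<close>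
  into \<open>e + d ** S\<close>, and likewise for the primed side; after substitution all terms
  outside \<delta>(z) X \<delta>(w)' belong to G and z G.\<close>

lemma kernel_identity:
  fixes d e C :: "'a::ring_1^'q^'p" and d' e' C' :: "'a^'p^'q" and R S S' B B' :: "'a^'q^'q"
    and J :: "'a^'p^'p"
  assumes e: "e ** B = C - d" and e': "B' ** e' = C' - d'"
    and S: "B ** S = mat 1" and S': "S' ** B' = mat 1" and J: "J ** J = mat 1"
  shows "J - (mat 1 - d ** (R ** S' ** C' ** J)) ** J ** (mat 1 - J ** C ** S ** R ** d')
    = (d + e) ** R ** (d' + e') - e ** R ** e'
      + d ** (S ** R + R ** S' - R - R ** S' ** (C' ** J ** C) ** S ** R) ** d'"
proof -
  have JJ: "M ** J ** J = M" for M :: "'a^'p^'m" by (simp add: J flip: matrix_mul_assoc)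
  have "C ** S = (e ** B + d) ** S" using e by simp
  also have "\<dots> = e + d ** S" by (simp add: matrix_distrib S flip: matrix_mul_assoc)
  finally have CS: "C ** S = e + d ** S" .
  have "S' ** C' = S' ** (B' ** e' + d')" using e' by simp
  also have "\<dots> = e' + S' ** d'" by (simp add: matrix_distrib S' matrix_mul_assoc)
  finally have SC: "S' ** C' = e' + S' ** d'" .
  have "J - (mat 1 - d ** (R ** S' ** C' ** J)) ** J ** (mat 1 - J ** C ** S ** R ** d')
    = d ** R ** (S' ** C') + (C ** S) ** R ** d'
      - d ** (R ** S' ** (C' ** J ** C) ** S ** R) ** d'"
    by (simp add: matrix_distrib matrix_mul_assoc JJ J)
  also have "\<dots> = (d + e) ** R ** (d' + e') - e ** R ** e'
      + d ** (S ** R + R ** S' - R - R ** S' ** (C' ** J ** C) ** S ** R) ** d'"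
    unfolding CS SC by (simp add: matrix_distrib matrix_mul_assoc)
  finally show ?thesis .
qed

theorem proposition8p3:
  fixes A P :: "grassmann^'q^'q" and C :: "grassmann^'q^'p" and J :: "grassmann^'p^'p"
  assumes "invertible (mat 1 - A)"
    and "observable C A"
    and "signature_matrix J"
    and "invertible P" and "adjoint_mat P = P"
  shows "(\<exists>U. open U \<and> 0 \<in> U \<and>
            (\<forall>z\<in>U. \<forall>w\<in>U.
              (\<lambda>n. rscale (lscale (z ^ n)
                     (J - Theta A C J P z ** J ** adjoint_mat (Theta A C J P w))) (dagger w ^ n))
                sums resolvent_kernel A C P z w))
         \<longleftrightarrow> P - adjoint_mat A ** P ** A = adjoint_mat C ** J ** C"
proof -
  define R S where "R = matrix_inv P" and "S = matrix_inv (mat 1 - A)"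
  have S: "(mat 1 - A) ** S = mat 1" "S ** (mat 1 - A) = mat 1"
    using matrix_inv_props[OF assms(1)] by (simp_all add: S_def)
  have R: "P ** R = mat 1" "R ** P = mat 1"
    using matrix_inv_props[OF assms(4)] by (simp_all add: R_def)
  have S': "(mat 1 - adjoint_mat A) ** adjoint_mat S = mat 1"
    "adjoint_mat S ** (mat 1 - adjoint_mat A) = mat 1"
    using arg_cong[OF S(2), of adjoint_mat] arg_cong[OF S(1), of adjoint_mat]
    by (simp_all add: adjoint_mult adjoint_diff adjoint_mat_1)
  have "adjoint_mat R ** P = mat 1"
    using arg_cong[OF R(1), of adjoint_mat] by (simp add: adjoint_mult adjoint_mat_1 assms(5))
  \<comment> \<open>The adjoint of \<open>R\<close> is a left inverse of the self-adjoint
    \<open>P\<close>, hence equal to the right inverse \<open>R\<close>.\<close>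
  then have "adjoint_mat R ** (P ** R) = R" by (simp add: matrix_mul_assoc)
  then have R': "adjoint_mat R = R" by (simp add: R)
  have adj_J: "adjoint_mat J = J"
    using assms(3) unfolding signature_matrix_def by (rule conjunct1[THEN sym])
  have J: "J ** J = mat 1"
    using assms(3) unfolding signature_matrix_def adj_J by (rule conjunct2)

  define K \<delta> where "K z w = resolvent_kernel A C P z w"
    and "\<delta> z = resolvent A C z - lscale z (resolvent A C z)" for z w
  define X where "X = S ** R + R ** adjoint_mat S - R
      - R ** adjoint_mat S ** (adjoint_mat C ** J ** C) ** S ** R"
  define D where "D z w = J - Theta A C J P z ** J ** adjoint_mat (Theta A C J P w)" for z w
  have X: "X = 0 \<longleftrightarrow> P - adjoint_mat A ** P ** A = adjoint_mat C ** J ** C"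
    using Stein_equation_iff[OF S S' R, of "adjoint_mat C ** J ** C"] by (simp add: X_def)

  \<comment> \<open>The summand 1 keeps the quotient defined when \<open>A\<close> is 0 and makes r
    at most 1/2, so that powers of z tend to 0 and real t < r differ from 1.\<close>
  define r where "r = 1 / (2 * (1 + entry_norm A))"
  have "0 < r" and r1: "r \<le> 1/2" and rA: "r * entry_norm A \<le> 1/2"
    using entry_norm_nonneg[of A] by (auto simp: r_def field_simps)
  have small: "norm z * entry_norm A \<le> 1/2" if "norm z < r" for z :: grassmann
    using mult_right_mono[of "norm z" r "entry_norm A"] that rA by (simp add: entry_norm_nonneg)

  have D_eq: "D z w = K z w - rscale (lscale z (K z w)) (dagger w) + \<delta> z ** X ** adjoint_mat (\<delta> w)"
    if z: "norm z < r" and w: "norm w < r" for z w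
  proof -
    let ?e = "\<lambda>z. lscale z (resolvent A C z)"
    \<comment> \<open>By the functional equation, z G(z) A is G(z) - C.\<close>
    have e: "?e z ** (mat 1 - A) = C - \<delta> z" if "norm z < r" for z
    proof -
      have "e - eA = c - (g - e)" if "g = c + eA" for g c e eA :: "grassmann^'q^'p"
        using that by simp
      from this[OF resolvent_eq[OF small[OF that], of C]] show ?thesis
        by (simp add: \<delta>_def matrix_distrib)
    qed
    have e': "(mat 1 - adjoint_mat A) ** adjoint_mat (?e w) = adjoint_mat C - adjoint_mat (\<delta> w)"
      using arg_cong[OF e[OF w], of adjoint_mat]
      by (simp add: adjoint_mult adjoint_diff adjoint_mat_1)
    have Tz: "Theta A C J P z = mat 1 - \<delta> z ** (R ** adjoint_mat S ** adjoint_mat C ** J)"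
      unfolding \<delta>_def R_def S_def by (rule Theta_eq[OF small[OF z]])
    have "Theta A C J P w = mat 1 - \<delta> w ** (R ** adjoint_mat S ** adjoint_mat C ** J)"
      unfolding \<delta>_def R_def S_def by (rule Theta_eq[OF small[OF w]])
    then have Tw: "adjoint_mat (Theta A C J P w) = mat 1 - J ** C ** S ** R ** adjoint_mat (\<delta> w)"
      by (simp add: adjoint_mult adjoint_diff adjoint_mat_1 adjoint_adjoint adj_J R' matrix_mul_assoc)
    have K: "K z w = (\<delta> z + ?e z) ** R ** (adjoint_mat (\<delta> w) + adjoint_mat (?e w))"
      unfolding K_def resolvent_kernel_eq[OF small[OF w]] by (simp add: \<delta>_def adjoint_diff R_def)
    have "rscale (lscale z (K z w)) (dagger w) = ?e z ** R ** adjoint_mat (?e w)"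
      unfolding K_def resolvent_kernel_eq[OF small[OF w]] R_def
      by (simp add: lscale_matrix_mul rscale_matrix_mul adjoint_lscale)
    then show ?thesis
      unfolding D_def Tz Tw K X_def
      using kernel_identity[OF e[OF z] e' S(1) S'(2) J] by simp
  qed

  have "(\<exists>U. open U \<and> 0 \<in> U \<and> (\<forall>z\<in>U. \<forall>w\<in>U.
      (\<lambda>n. rscale (lscale (z ^ n) (D z w)) (dagger w ^ n)) sums K z w)) \<longleftrightarrow> X = 0"
  proof
    assume "X = 0"
    have "(\<lambda>n. rscale (lscale (z ^ n) (D z w)) (dagger w ^ n)) sums K z w"
      if z: "z \<in> ball 0 r" and w: "w \<in> ball 0 r" for z w
    proof -
      \<comment> \<open>With X = 0 the n-th summand is \<open>?h n - ?h (Suc n)\<close>, and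
        \<open>?h\<close> tends to 0, so the sum is \<open>?h 0\<close>, which is K.\<close>
      let ?h = "\<lambda>n. rscale (lscale (z ^ n) (K z w)) (dagger w ^ n)"
      have "norm z < 1" "norm (dagger w) < 1"
        using z w r1 by (auto simp: norm_dagger)
      then have "(\<lambda>n. z ^ n) \<longlonglongrightarrow> 0" "(\<lambda>n. dagger w ^ n) \<longlonglongrightarrow> 0"
        by (simp_all add: LIMSEQ_power_zero)
      then have "?h \<longlonglongrightarrow> 0"
        by (intro vec_tendstoI) (auto simp: rscale_def lscale_def intro!: tendsto_mult_zero tendsto_mult_left_zero)
      from telescope_sums'[OF this] have "(\<lambda>n. ?h n - ?h (Suc n)) sums K z w"
        by (simp add: lscale_1 rscale_1)
      moreover have "D z w = K z w - rscale (lscale z (K z w)) (dagger w)"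
        using D_eq z w \<open>X = 0\<close> by simp
      then have "rscale (lscale (z ^ n) (D z w)) (dagger w ^ n) = ?h n - ?h (Suc n)" for n
        by (simp add: lscale_diff rscale_diff lscale_rscale lscale_lscale rscale_rscale
            flip: power_Suc power_Suc2)
      ultimately show ?thesis by simp
    qed
    then show "\<exists>U. open U \<and> 0 \<in> U \<and> (\<forall>z\<in>U. \<forall>w\<in>U.
        (\<lambda>n. rscale (lscale (z ^ n) (D z w)) (dagger w ^ n)) sums K z w)"
      using \<open>0 < r\<close> by (intro exI[of _ "ball 0 r"]) simp
  next
    assume "\<exists>U. open U \<and> 0 \<in> U \<and> (\<forall>z\<in>U. \<forall>w\<in>U.
        (\<lambda>n. rscale (lscale (z ^ n) (D z w)) (dagger w ^ n)) sums K z w)"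
    then obtain U where "open U" "0 \<in> U"
      and U: "\<And>z w. z \<in> U \<Longrightarrow> w \<in> U \<Longrightarrow>
        (\<lambda>n. rscale (lscale (z ^ n) (D z w)) (dagger w ^ n)) sums K z w"
      by blast
    then obtain r0 where "0 < r0" and r0: "ball 0 r0 \<subseteq> U"
      by (meson open_contains_ball)
    have X0: "\<delta> z ** X ** adjoint_mat (\<delta> w) = 0"
      if z: "norm z < r" "norm z < r0" and w: "norm w < r" "norm w < r0" for z w
    proof -
      let ?f = "\<lambda>n. rscale (lscale (z ^ n) (D z w)) (dagger w ^ n)"
      have f: "?f sums K z w"
        using r0 z w by (intro U) auto
      \<comment> \<open>Multiplying by z on the left and by \<open>dagger w\<close> on the right
        shifts the series, so the difference from the original sum is its first term
        \<open>D z w\<close>.\<close>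
      have "(\<lambda>n. rscale (lscale z (?f n)) (dagger w)) sums rscale (lscale z (K z w)) (dagger w)"
        by (intro sums_rscale sums_lscale f)
      also have "(\<lambda>n. rscale (lscale z (?f n)) (dagger w)) = (\<lambda>n. ?f (Suc n))"
        by (simp add: lscale_rscale lscale_lscale rscale_rscale flip: power_Suc power_Suc2)
      finally have "?f sums (rscale (lscale z (K z w)) (dagger w) + ?f 0)"
        by (rule sums_Suc)
      then have K: "K z w = rscale (lscale z (K z w)) (dagger w) + ?f 0"
        by (rule sums_unique2[OF f])
      have D: "D z w = ?f 0" by (simp add: lscale_1 rscale_1)
      have "x = 0" if "k = s + d" "d = k - s + x" for k s d x :: "grassmann^'p^'p"
        using that by simp
      from this[OF K, folded D, OF D_eq[OF z(1) w(1)]] show ?thesis .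
    qed
    define \<rho> where "\<rho> = min r r0"
    have \<rho>: "0 < \<rho>" "\<rho> * entry_norm A \<le> 1/2"
      using \<open>0 < r\<close> \<open>0 < r0\<close> rA mult_right_mono[of \<rho> r "entry_norm A"]
      by (auto simp: \<rho>_def entry_norm_nonneg)
    \<comment> \<open>At a real point the \<star>-factor becomes the number 1 - t, which is nonzero
      for t < r and can be cancelled.\<close>
    have \<delta>_real: "\<delta> (of_real t) = (1 - t) *\<^sub>R resolvent A C (of_real t)" for t
      by (simp add: \<delta>_def lscale_of_real scaleR_left_diff_distrib)
    have GXG: "resolvent A C (of_real t) ** (X ** adjoint_mat (resolvent A C (of_real s))) = 0"
      if "0 < t" "t < \<rho>" "0 < s" "s < \<rho>" for t s
    proof -
      have "\<delta> (of_real t) ** X ** adjoint_mat (\<delta> (of_real s)) = 0"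
        using that by (intro X0) (auto simp: \<rho>_def)
      moreover have "t \<noteq> 1" "s \<noteq> 1"
        using that r1 by (auto simp: \<rho>_def)
      ultimately show ?thesis
        by (simp add: \<delta>_real adjoint_scaleR matrix_scalar_ac matrix_mul_assoc
            flip: scalar_matrix_assoc)
    qed
    \<comment> \<open>Cancelling on the left leaves X times the adjoint of G(s); taking adjoints
      brings G(s) to the left, ready for the second cancellation.\<close>
    have "resolvent A C (of_real s) ** adjoint_mat X = 0" if "0 < s" "s < \<rho>" for s
    proof -
      have "X ** adjoint_mat (resolvent A C (of_real s)) = 0"
        by (rule resolvent_cancel[OF assms(2) \<rho>]) (use GXG that in auto)
      from arg_cong[OF this, of adjoint_mat] show ?thesis
        by (simp add: adjoint_mult adjoint_adjoint adjoint_0)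
    qed
    then have "adjoint_mat X = 0"
      by (rule resolvent_cancel[OF assms(2) \<rho>])
    from arg_cong[OF this, of adjoint_mat] show "X = 0"
      by (simp add: adjoint_adjoint adjoint_0)
  qed
  then show ?thesis
    unfolding X K_def D_def .
qed

end
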